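(* Let $p$ be a prime, and let $a,b,c,d$ be integers with $0\le b\le a$. Then the limit $\lim_{e\to\infty} S(p^e a+c,\,p^e b+d)$ exists in $\mathbb{Z}_p$ (with respect to the $p$-adic metric).
   Context: $\mathbb{Z}_p$ denotes the $p$-adic integers with the usual $p$-adic metric. $S(n,k)$ denotes the Stirling numbers of the second kind, with $S(0,0)=1$ and $S(n,k)=kS(n-1,k)+S(n-1,k-1)$. Convention for negative arguments (relevant only in the degenerate cases $a=0$, or $b=0$ and $d<0$): $S$ is extended to all pairs of integers by the same recurrence, i.e. $S(n,k)=0$ if exactly one of $n,k$ is negative, and $S(-n,-k)=|s(k,n)|$ for $n,k\ge1$, where $|s(k,n)|$ is the unsigned Stirling number of the first kind. *)

theory Defs
  imports
    "HOL-Analysis.Analysis"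
    "HOL-Combinatorics.Stirling"
    "HOL-Computational_Algebra.Primes"
begin

text \<open>
  Stirling numbers of the second kind, extended to all pairs of integers. Note the swap of
  arguments in the negative quadrant: \<open>S(-n, -k) = |s(k, n)|\<close>.
\<close>

definition Stirling_int :: "int \<Rightarrow> int \<Rightarrow> int" where
  "Stirling_int n k =
     (if 0 \<le> n \<and> 0 \<le> k then int (Stirling (nat n) (nat k))
      else if n < 0 \<and> k < 0 then int (stirling (nat (- k)) (nat (- n)))
      else 0)"

lemma Stirling_int_of_nat: "Stirling_int (int n) (int k) = int (Stirling n k)"
  by (simp add: Stirling_int_def)

lemma Stirling_int_rec:
  "Stirling_int n k = k * Stirling_int (n - 1) k + Stirling_int (n - 1) (k - 1)"
proof -
  consider (pp) "n \<ge> 1" "k \<ge> 1" | (p0) "n \<ge> 1" "k = 0" | (pn) "n \<ge> 1" "k < 0"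
    | (zz) "n = 0" "k = 0" | (zp) "n = 0" "k > 0" | (zn) "n = 0" "k < 0"
    | (np) "n < 0" "k > 0" | (n0) "n < 0" "k = 0" | (nn) "n < 0" "k < 0"
    by linarith
  then show ?thesis
  proof cases
    case pp
    define m l where "m = nat (n - 1)" and "l = nat (k - 1)"
    have "n = int (Suc m)" "k = int (Suc l)"
      using pp by (simp_all add: m_def l_def)
    then show ?thesis
      by (simp add: Stirling_int_def nat_add_distrib algebra_simps)
  next
    case p0
    define m where "m = nat (n - 1)"
    have "n = int (Suc m)"
      using p0 by (simp add: m_def)
    with p0 show ?thesis
      by (simp add: Stirling_int_def nat_add_distrib)
  next
    case zn
    define l where "l = nat (- k - 1)"
    have k: "k = - int (Suc l)"
      using zn by (simp add: l_def)
    have "nat (- (k - 1)) = Suc (Suc l)" "nat (- k) = Suc l"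
      using zn by (simp_all add: l_def)
    then have "Stirling_int (n - 1) (k - 1) = fact (Suc l)" "Stirling_int (n - 1) k = fact l"
      using zn stirling_Suc_n_1[of l] stirling_Suc_n_1[of "Suc l"]
      by (simp_all add: Stirling_int_def distrib_right del: stirling.simps)
    moreover have "k * fact l + fact (Suc l) = 0"
      unfolding k by (simp add: algebra_simps)
    moreover have "Stirling_int n k = 0"
      using zn by (simp add: Stirling_int_def)
    ultimately show ?thesis
      by simp
  next
    case nn
    define m l where "m = nat (- n - 1)" and "l = nat (- k - 1)"
    have k: "k = - int (Suc l)"
      using nn by (simp add: l_def)
    have "nat (- n) = Suc m" "nat (- (n - 1)) = Suc (Suc m)"
      "nat (- k) = Suc l" "nat (- (k - 1)) = Suc (Suc l)"
      using nn by (simp_all add: m_def l_def)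
    then have "Stirling_int n k = int (stirling (Suc l) (Suc m))"
      "Stirling_int (n - 1) k = int (stirling (Suc l) (Suc (Suc m)))"
      "Stirling_int (n - 1) (k - 1) = int (stirling (Suc (Suc l)) (Suc (Suc m)))"
      using nn by (simp_all add: Stirling_int_def del: stirling.simps)
    moreover have "stirling (Suc (Suc l)) (Suc (Suc m)) =
        Suc l * stirling (Suc l) (Suc (Suc m)) + stirling (Suc l) (Suc m)"
      by (rule stirling.simps)
    moreover have "k * z + (int (Suc l) * z + w) = w" for z w
      unfolding k by (simp add: algebra_simps)
    ultimately show ?thesis
      by (simp only: of_nat_add of_nat_mult)
  qed (auto simp: Stirling_int_def)
qed

text \<open>
  The \<open>p\<close>-adic integers as the inverse limit of the rings \<open>\<int>/p\<^sup>n\<int>\<close>: the \<open>n\<close>-th component of an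
  element is its residue modulo \<open>p\<^sup>n\<close>, represented in \<open>{0..<p\<^sup>n}\<close>.
\<close>

definition padic_ints :: "nat \<Rightarrow> (nat \<Rightarrow> int) set" where
  "padic_ints p = {x. \<forall>n. x n \<in> {0..<int p ^ n} \<and> x (Suc n) mod int p ^ n = x n}"

definition padic_of_int :: "nat \<Rightarrow> int \<Rightarrow> nat \<Rightarrow> int" where
  "padic_of_int p m = (\<lambda>n. m mod int p ^ n)"

definition padic_minus :: "nat \<Rightarrow> (nat \<Rightarrow> int) \<Rightarrow> (nat \<Rightarrow> int) \<Rightarrow> nat \<Rightarrow> int" where
  "padic_minus p x y = (\<lambda>n. (x n - y n) mod int p ^ n)"

text \<open>
  The valuation of \<open>x \<noteq> 0\<close> is the largest \<open>v\<close> with \<open>x\<close> divisible by \<open>p\<^sup>v\<close>, which by coherence is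
  the least \<open>v\<close> such that the residue of \<open>x\<close> modulo \<open>p\<^bsup>v+1\<^esup>\<close> is nonzero.
\<close>

definition padic_val :: "(nat \<Rightarrow> int) \<Rightarrow> nat" where
  "padic_val x = (LEAST v. x (Suc v) \<noteq> 0)"

definition padic_abs :: "nat \<Rightarrow> (nat \<Rightarrow> int) \<Rightarrow> real" where
  "padic_abs p x = (if x = (\<lambda>_. 0) then 0 else 1 / real p ^ padic_val x)"

definition padic_dist :: "nat \<Rightarrow> (nat \<Rightarrow> int) \<Rightarrow> (nat \<Rightarrow> int) \<Rightarrow> real" where
  "padic_dist p x y = padic_abs p (padic_minus p x y)"

abbreviation padic_topology :: "nat \<Rightarrow> (nat \<Rightarrow> int) topology" where
  "padic_topology p \<equiv> Metric_space.mtopology (padic_ints p) (padic_dist p)"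

lemma padic_ints_mod:
  assumes "x \<in> padic_ints p" "m \<le> n"
  shows "x n mod int p ^ m = x m"
  using assms(2)
proof (induction n rule: dec_induct)
  case base
  then show ?case using assms(1) by (auto simp: padic_ints_def)
next
  case (step n)
  have "x (Suc n) mod int p ^ m = x (Suc n) mod int p ^ n mod int p ^ m"
    using step(1) by (simp add: mod_mod_cancel le_imp_power_dvd)
  also have "\<dots> = x m"
    using assms(1) step.IH by (simp add: padic_ints_def)
  finally show ?case .
qed

lemma padic_of_int_in_padic_ints:
  assumes "p > 0"
  shows "padic_of_int p m \<in> padic_ints p"
  using assms by (auto simp: padic_ints_def padic_of_int_def intro!: mod_mod_cancel)

lemma padic_minus_in_padic_ints:
  assumes "p > 0" "x \<in> padic_ints p" "y \<in> padic_ints p"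
  shows "padic_minus p x y \<in> padic_ints p"
proof -
  have "(x (Suc n) - y (Suc n)) mod int p ^ Suc n mod int p ^ n = (x n - y n) mod int p ^ n" for n
  proof -
    have "(x (Suc n) - y (Suc n)) mod int p ^ Suc n mod int p ^ n
        = (x (Suc n) - y (Suc n)) mod int p ^ n"
      by (rule mod_mod_cancel) simp
    also have "\<dots> = (x (Suc n) mod int p ^ n - y (Suc n) mod int p ^ n) mod int p ^ n"
      by (simp add: mod_diff_eq)
    finally show ?thesis
      using assms by (simp add: padic_ints_def)
  qed
  then show ?thesis
    using assms(1) by (auto simp: padic_ints_def padic_minus_def)
qed

lemma padic_abs_le_iff:
  assumes "p > 1" "x \<in> padic_ints p"
  shows "padic_abs p x \<le> 1 / real p ^ n \<longleftrightarrow> x n = 0"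
proof (cases "x = (\<lambda>_. 0)")
  case False
  have x0: "x 0 = 0"
    using assms(2) by (auto simp: padic_ints_def dest: spec[of _ 0])
  have down: "x i = 0" if "x j = 0" "i \<le> j" for i j
    using padic_ints_mod[OF assms(2) that(2)] that(1) by simp
  obtain k where "x k \<noteq> 0" using False by auto
  then have "\<exists>v. x (Suc v) \<noteq> 0" using x0 by (cases k) auto
  then have nz: "x (Suc (padic_val x)) \<noteq> 0"
    unfolding padic_val_def by (rule LeastI_ex)
  have z: "x (padic_val x) = 0"
  proof (cases "padic_val x")
    case (Suc w)
    then have "\<not> x (Suc w) \<noteq> 0"
      unfolding padic_val_def by (intro not_less_Least) auto
    with Suc show ?thesis by simp
  qed (simp add: x0)
  have "padic_abs p x \<le> 1 / real p ^ n \<longleftrightarrow> real p ^ n \<le> real p ^ padic_val x"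
    using False assms(1) by (simp add: padic_abs_def field_simps)
  also have "\<dots> \<longleftrightarrow> n \<le> padic_val x"
    using assms(1) by simp
  also have "\<dots> \<longleftrightarrow> x n = 0"
  proof
    assume "n \<le> padic_val x"
    then show "x n = 0" using down[OF z] by blast
  next
    assume "x n = 0"
    then show "n \<le> padic_val x"
      using down[of n "Suc (padic_val x)"] nz not_less_eq_eq by blast
  qed
  finally show ?thesis .
qed (simp add: padic_abs_def)

lemma padic_dist_le_iff:
  assumes "p > 1" "x \<in> padic_ints p" "y \<in> padic_ints p"
  shows "padic_dist p x y \<le> 1 / real p ^ n \<longleftrightarrow> x n = y n"
proof -
  have "padic_minus p x y n = 0 \<longleftrightarrow> x n mod int p ^ n = y n mod int p ^ n"
    by (simp add: padic_minus_def mod_eq_dvd_iff dvd_eq_mod_eq_0)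
  also have "\<dots> \<longleftrightarrow> x n = y n"
    using padic_ints_mod[of x p n n] padic_ints_mod[of y p n n] assms by simp
  finally show ?thesis
    using padic_abs_le_iff[OF assms(1) padic_minus_in_padic_ints[of p x y]] assms
    by (simp add: padic_dist_def)
qed

lemma padic_dist_cases:
  obtains "padic_dist p x y = 0" | n where "padic_dist p x y = 1 / real p ^ n"
  unfolding padic_dist_def padic_abs_def by (cases "padic_minus p x y = (\<lambda>_. 0)") auto

lemma padic_dist_eq_0_iff:
  assumes "p > 1" "x \<in> padic_ints p" "y \<in> padic_ints p"
  shows "padic_dist p x y = 0 \<longleftrightarrow> x = y"
proof
  assume "padic_dist p x y = 0"
  then have "x n = y n" for n
    using padic_dist_le_iff[OF assms, of n] by simp
  then show "x = y" by auto
qed (simp add: padic_dist_def padic_abs_def padic_minus_def)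

lemma padic_dist_nonneg: "padic_dist p x y \<ge> 0"
  by (simp add: padic_dist_def padic_abs_def)

lemma padic_dist_ultrametric:
  assumes "p > 1" "x \<in> padic_ints p" "y \<in> padic_ints p" "z \<in> padic_ints p"
  shows "padic_dist p x z \<le> max (padic_dist p x y) (padic_dist p y z)"
proof -
  have main: "padic_dist p x z \<le> 1 / real p ^ n"
    if "padic_dist p x y \<le> 1 / real p ^ n" "padic_dist p y z \<le> 1 / real p ^ n" for n
    using that assms by (simp add: padic_dist_le_iff)
  have "max (padic_dist p x y) (padic_dist p y z) = 0 \<or>
      (\<exists>n. max (padic_dist p x y) (padic_dist p y z) = 1 / real p ^ n)"
    using padic_dist_cases[of p x y] padic_dist_cases[of p y z] unfolding max_def by metis
  then show ?thesis
  proof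
    assume m: "max (padic_dist p x y) (padic_dist p y z) = 0"
    then have "padic_dist p x y = 0" "padic_dist p y z = 0"
      using padic_dist_nonneg[of p x y] padic_dist_nonneg[of p y z] by linarith+
    then have "x = z"
      using assms by (simp add: padic_dist_eq_0_iff)
    then show ?thesis
      using m assms padic_dist_eq_0_iff[of p x z] by simp
  next
    assume "\<exists>n. max (padic_dist p x y) (padic_dist p y z) = 1 / real p ^ n"
    then obtain n where n: "max (padic_dist p x y) (padic_dist p y z) = 1 / real p ^ n" ..
    then have "padic_dist p x y \<le> 1 / real p ^ n" "padic_dist p y z \<le> 1 / real p ^ n"
      by (metis max.cobounded1 max.cobounded2)+
    then show ?thesis using main n by simp
  qed
qed

lemma padic_dist_commute: "padic_dist p x y = padic_dist p y x"
proof -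
  have "padic_minus p x y n = 0 \<longleftrightarrow> padic_minus p y x n = 0" for n
    unfolding padic_minus_def dvd_eq_mod_eq_0[symmetric] by (rule dvd_diff_commute)
  then show ?thesis
    by (simp add: padic_dist_def padic_abs_def padic_val_def fun_eq_iff)
qed

lemma Metric_space_padic:
  assumes "prime p"
  shows "Metric_space (padic_ints p) (padic_dist p)"
proof -
  have p: "p > 1" using assms by (rule prime_gt_1_nat)
  show ?thesis
  proof
    fix x y z assume "x \<in> padic_ints p" "y \<in> padic_ints p" "z \<in> padic_ints p"
    then show "padic_dist p x z \<le> padic_dist p x y + padic_dist p y z"
      using padic_dist_ultrametric[OF p, of x y z] padic_dist_nonneg[of p x y]
        padic_dist_nonneg[of p y z] by linarith
  qed (use p in \<open>simp_all add: padic_dist_nonneg padic_dist_eq_0_iff padic_dist_commute\<close>)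
qed

lemma ex_inverse_power_less:
  assumes "prime (p::nat)" "(r::real) > 0"
  shows "\<exists>n. 1 / real p ^ n < r"
  using real_arch_pow_inv[of r "1 / real p"] assms prime_gt_1_nat[of p]
  by (auto simp: power_one_over)

lemma limitin_padic_iff:
  assumes p: "prime p" and s: "\<And>e. s e \<in> padic_ints p"
  shows "limitin (padic_topology p) s L F \<longleftrightarrow>
    L \<in> padic_ints p \<and> (\<forall>n. \<forall>\<^sub>F e in F. s e n = L n)"
proof -
  interpret Metric_space "padic_ints p" "padic_dist p"
    using p by (rule Metric_space_padic)
  have p1: "p > 1" using p by (rule prime_gt_1_nat)
  have "(\<forall>\<epsilon>>0. \<forall>\<^sub>F e in F. padic_dist p (s e) L < \<epsilon>) \<longleftrightarrow> (\<forall>n. \<forall>\<^sub>F e in F. s e n = L n)"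
    if L: "L \<in> padic_ints p"
  proof (intro iffI allI impI)
    fix n assume *: "\<forall>\<epsilon>>0. \<forall>\<^sub>F e in F. padic_dist p (s e) L < \<epsilon>"
    have "\<forall>\<^sub>F e in F. padic_dist p (s e) L < 1 / real p ^ n"
      using * p1 by simp
    then show "\<forall>\<^sub>F e in F. s e n = L n"
      by eventually_elim (simp add: padic_dist_le_iff[OF p1 s L, symmetric])
  next
    fix \<epsilon> :: real assume *: "\<forall>n. \<forall>\<^sub>F e in F. s e n = L n" and "\<epsilon> > 0"
    then obtain n where n: "1 / real p ^ n < \<epsilon>"
      using ex_inverse_power_less[OF p] by blast
    have "\<forall>\<^sub>F e in F. s e n = L n"
      using * by blast
    then show "\<forall>\<^sub>F e in F. padic_dist p (s e) L < \<epsilon>"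
    proof eventually_elim
      case (elim e)
      then show ?case
        using padic_dist_le_iff[OF p1 s L, of e n] n by simp
    qed
  qed
  then show ?thesis
    using s by (auto simp: limitin_metric)
qed

text \<open>
  The following three lemmas say that \<open>padic_ints p\<close> is the completion of \<open>\<int>\<close> with respect to
  the \<open>p\<close>-adic metric.
\<close>

lemma padic_dist_of_int:
  assumes "prime p"
  shows "padic_dist p (padic_of_int p m) (padic_of_int p n) =
    (if m = n then 0 else 1 / real p ^ multiplicity (int p) (m - n))"
proof (cases "m = n")
  case True
  then show ?thesis
    by (simp add: padic_dist_def padic_minus_def padic_abs_def)
next
  case False
  have p1: "p > 1" using assms by (rule prime_gt_1_nat)
  let ?d = "padic_dist p (padic_of_int p m) (padic_of_int p n)"
  have le: "?d \<le> 1 / real p ^ j \<longleftrightarrow> j \<le> multiplicity (int p) (m - n)" for j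
  proof -
    have "?d \<le> 1 / real p ^ j \<longleftrightarrow> padic_of_int p m j = padic_of_int p n j"
      using p1 by (intro padic_dist_le_iff padic_of_int_in_padic_ints) auto
    also have "\<dots> \<longleftrightarrow> int p ^ j dvd m - n"
      by (simp add: padic_of_int_def mod_eq_dvd_iff)
    also have "\<dots> \<longleftrightarrow> j \<le> multiplicity (int p) (m - n)"
      using False p1 by (intro power_dvd_iff_le_multiplicity) auto
    finally show ?thesis .
  qed
  show ?thesis
  proof (rule padic_dist_cases[of p "padic_of_int p m" "padic_of_int p n"])
    assume "?d = 0"
    then show ?thesis
      using le[of "Suc (multiplicity (int p) (m - n))"] by simp
  next
    fix k assume k: "?d = 1 / real p ^ k"
    have "j \<le> k \<longleftrightarrow> j \<le> multiplicity (int p) (m - n)" for j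
      using le[of j] p1 unfolding k by (simp add: field_simps)
    then have "k = multiplicity (int p) (m - n)"
      by (metis order_antisym order_refl)
    then show ?thesis
      using k False by simp
  qed
qed

lemma padic_of_int_dense:
  assumes "prime p"
  shows "padic_topology p closure_of range (padic_of_int p) = padic_ints p"
proof -
  interpret Metric_space "padic_ints p" "padic_dist p"
    using assms by (rule Metric_space_padic)
  have p1: "p > 1" using assms by (rule prime_gt_1_nat)
  have mem: "padic_of_int p m \<in> padic_ints p" for m
    using p1 by (intro padic_of_int_in_padic_ints) auto
  have "\<exists>m. padic_dist p x (padic_of_int p m) < r" if x: "x \<in> padic_ints p" and "r > 0" for x r
  proof -
    obtain n where n: "1 / real p ^ n < r"
      using ex_inverse_power_less[OF assms \<open>r > 0\<close>] by blast
    have "x n = padic_of_int p (x n) n"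
      using padic_ints_mod[OF x, of n n] by (simp add: padic_of_int_def)
    then show ?thesis
      using padic_dist_le_iff[OF p1 x mem, of "x n" n] n by (intro exI[of _ "x n"]) linarith
  qed
  then show ?thesis
    using mem by (auto simp: metric_closure_of)
qed

lemma mcomplete_padic:
  assumes "prime p"
  shows "Metric_space.mcomplete (padic_ints p) (padic_dist p)"
proof -
  interpret Metric_space "padic_ints p" "padic_dist p"
    using assms by (rule Metric_space_padic)
  have p1: "p > 1" using assms by (rule prime_gt_1_nat)
  show ?thesis
    unfolding mcomplete_def
  proof (intro allI impI)
    fix s assume C: "MCauchy s"
    then have s: "s i \<in> padic_ints p" for i
      by (auto simp: MCauchy_def)
    have "\<exists>N. \<forall>i\<ge>N. s i n = s N n" for n
    proof -
      have "1 / real p ^ n > 0" using p1 by simp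
      with C obtain N where "\<forall>i j. N \<le> i \<longrightarrow> N \<le> j \<longrightarrow> padic_dist p (s i) (s j) < 1 / real p ^ n"
        unfolding MCauchy_def by blast
      then have "s i n = s N n" if "i \<ge> N" for i
        using that padic_dist_le_iff[OF p1 s s, of i N n] by (simp add: less_imp_le)
      then show ?thesis by blast
    qed
    then obtain N where N: "\<And>n i. i \<ge> N n \<Longrightarrow> s i n = s (N n) n"
      by metis
    define L where "L n = s (N n) n" for n
    have L: "L \<in> padic_ints p"
    proof -
      have "L (Suc n) mod int p ^ n = L n" for n
      proof -
        define i where "i = max (N n) (N (Suc n))"
        have "L (Suc n) = s i (Suc n)" "L n = s i n"
          using N[of n i] N[of "Suc n" i] by (simp_all add: i_def L_def)
        then show ?thesis
          using s[of i] by (simp add: padic_ints_def)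
      qed
      moreover have "L n \<in> {0..<int p ^ n}" for n
        using s[of "N n"] unfolding padic_ints_def L_def by blast
      ultimately show ?thesis
        by (simp add: padic_ints_def)
    qed
    have "\<forall>\<^sub>F e in sequentially. s e n = L n" for n
      unfolding L_def eventually_sequentially using N by blast
    then show "\<exists>L. limitin mtopology s L sequentially"
      using L by (auto simp: limitin_padic_iff[OF assms s])
  qed
qed

end

theory Submission
  imports Defs "HOL-Number_Theory.Cong" "HOL-Computational_Algebra.Polynomial_FPS"
begin

text \<open>
  Fix \<open>N\<close> and work modulo \<open>p\<^sup>N\<close>; it suffices that the sequence is eventually constant there.
  The series \<open>\<Sum>\<^sub>n S(n+k,k) X\<^sup>n\<close> is the inverse of \<open>P\<^sub>k = (1-X)(1-2X)\<dots>(1-kX)\<close>. Since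
  \<open>P\<^sub>p \<equiv> 1-X\<^bsup>p-1\<^esup>\<close> modulo \<open>p\<close>, raising to \<open>p\<close>-th powers gives, for \<open>e \<ge> 2N-1\<close>,
  \<open>P\<^sub>k \<equiv> (1-X\<^sup>T)\<^sup>Q\<close> modulo \<open>p\<^sup>N\<close> with \<open>k = p\<^sup>e\<close>, \<open>T = (p-1)p\<^bsup>e-N\<^esup>\<close> and \<open>Q = p\<^bsup>N-1\<^esup>\<close>.
  The point is that the exponent \<open>Q\<close> does not depend on \<open>e\<close>.

  By the recurrence \<open>S(n-1,k-1) = S(n,k) - k S(n-1,k)\<close>, if the claim holds for \<open>d\<close> and all \<open>c\<close>,
  it holds for \<open>d-1\<close> and all \<open>c\<close>, so one may take \<open>d = p\<^sup>M\<close> with \<open>M\<close> large. Then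
  \<open>S(p\<^sup>ea+c, p\<^sup>eb+d)\<close> is congruent to the sum of \<open>F\<^sub>j H(p\<^sup>e(a-b)+c-d-Tj)\<close> over a range of \<open>j\<close>
  independent of \<open>e\<close>, where \<open>F\<^sub>j\<close> are the coefficients of \<open>(1-X)\<^bsup>-Qb\<^esup>\<close> and \<open>H\<close> those of \<open>1/P\<^sub>d\<close>
  modulo \<open>p\<^sup>N\<close>. Each argument of \<open>H\<close> has the form \<open>p\<^bsup>e-N\<^esup>\<alpha>+\<beta>\<close>, and \<open>H\<close> vanishes on negative
  arguments and has a period \<open>(p-1)p\<^sup>R\<close> on the others, so each summand is eventually constant.
\<close>

subsection \<open>Congruences in commutative rings\<close>

text \<open>The library's congruence relation requires a Euclidean ring, which \<open>int fps\<close> is not.\<close>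

definition dcong :: "'a::comm_ring_1 \<Rightarrow> 'a \<Rightarrow> 'a \<Rightarrow> bool" where
  "dcong q x y \<longleftrightarrow> q dvd x - y"

lemma dcong_refl [simp, intro]: "dcong q x x"
  by (simp add: dcong_def)

lemma dcong_sym: "dcong q x y \<Longrightarrow> dcong q y x"
  unfolding dcong_def by (metis dvd_minus_iff minus_diff_eq)

lemma dcong_trans [trans]: "dcong q x y \<Longrightarrow> dcong q y z \<Longrightarrow> dcong q x z"
  using dvd_add[of q "x - y" "y - z"] by (simp add: dcong_def)

lemma dcong_mult: "dcong q x y \<Longrightarrow> dcong q u v \<Longrightarrow> dcong q (x * u) (y * v)"
proof -
  assume "dcong q x y" "dcong q u v"
  then have "q dvd (x - y) * u + y * (u - v)"
    by (simp add: dcong_def)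
  then show ?thesis
    by (simp add: dcong_def algebra_simps)
qed

lemma dcong_power: "dcong q x y \<Longrightarrow> dcong q (x ^ n) (y ^ n)"
  by (induction n) (auto intro: dcong_mult)

lemma dcong_dvd_modulus: "dcong q x y \<Longrightarrow> r dvd q \<Longrightarrow> dcong r x y"
  unfolding dcong_def by (rule dvd_trans)

text \<open>The identity u - v = u v (y - x) carries congruences of denominators over to their
  inverses, the generating functions.\<close>

lemma dcong_inverse:
  assumes "dcong q x y" "x * u = 1" "y * v = 1"
  shows "dcong q u v"
proof -
  have "u - v = u * v * (y - x)"
    using assms(2,3) by (simp add: algebra_simps) (metis mult.assoc mult.commute mult_1)
  moreover have "q dvd y - x"
    using dcong_sym[OF assms(1)] by (simp add: dcong_def)
  ultimately show ?thesis
    by (simp add: dcong_def)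
qed

text \<open>Each p-th power gains a factor p: in u^p - v^p = (u - v) * sum, every term of the sum is
  v^(p-1) modulo p, so its p terms add up to 0 modulo p.\<close>

lemma dcong_power_lift:
  fixes x y :: "'a::comm_ring_1"
  assumes "dcong (of_nat p) x y"
  shows "dcong (of_nat p ^ Suc n) (x ^ p ^ n) (y ^ p ^ n)"
proof (induction n)
  case 0
  then show ?case using assms by simp
next
  case (Suc n)
  define u v where "u = x ^ p ^ n" and "v = y ^ p ^ n"
  have uv: "dcong (of_nat p ^ Suc n) u v"
    using Suc by (simp add: u_def v_def)
  then have "dcong (of_nat p) u v"
    by (rule dcong_dvd_modulus) simp
  then have "dcong (of_nat p) (u ^ i) (v ^ i)" for i
    by (rule dcong_power)
  then have "of_nat p dvd v ^ (p - Suc i) * (u ^ i - v ^ i)" for i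
    by (simp add: dcong_def)
  then have "of_nat p dvd (\<Sum>i<p. v ^ (p - Suc i) * (u ^ i - v ^ i))"
    by (intro dvd_sum)
  moreover have "(\<Sum>i<p. v ^ (p - Suc i) * v ^ i) = of_nat p * v ^ (p - 1)"
  proof -
    have "v ^ (p - Suc i) * v ^ i = v ^ (p - 1)" if "i < p" for i
      using that by (simp flip: power_add)
    then show ?thesis by simp
  qed
  ultimately have "of_nat p dvd (\<Sum>i<p. v ^ (p - Suc i) * u ^ i)"
    by (simp add: right_diff_distrib sum_subtractf) (metis dvd_add_left_iff dvd_triv_left diff_add_cancel)
  then have "of_nat p ^ Suc n * of_nat p dvd u ^ p - v ^ p"
    unfolding power_diff_sumr2[of u p v] using uv by (intro mult_dvd_mono) (simp_all add: dcong_def)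
  then show ?case
    by (simp add: dcong_def u_def v_def mult.commute flip: power_mult)
qed

section \<open>Binomial, Lagrange and Fermat congruences modulo a prime\<close>

lemma dcong_freshmans_dream:
  fixes x y :: "'a::comm_ring_1"
  assumes "prime p"
  shows "dcong (of_nat p) ((x + y) ^ p) (x ^ p + y ^ p)"
proof -
  have p: "p > 0" using assms by (simp add: prime_gt_0_nat)
  have "(x + y) ^ p = (\<Sum>k\<in>{0..p}. of_nat (p choose k) * x ^ k * y ^ (p - k))"
    by (simp add: binomial_ring atLeast0AtMost)
  also have "{0..p} = insert 0 (insert p {0<..<p})"
    by auto
  also have "(\<Sum>k\<in>\<dots>. of_nat (p choose k) * x ^ k * y ^ (p - k)) =
      x ^ p + y ^ p + (\<Sum>k\<in>{0<..<p}. of_nat (p choose k) * x ^ k * y ^ (p - k))"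
    using p by simp
  finally have "(x + y) ^ p - (x ^ p + y ^ p) =
      (\<Sum>k\<in>{0<..<p}. of_nat (p choose k) * x ^ k * y ^ (p - k))"
    by simp
  moreover have "(of_nat p :: 'a) dvd of_nat (p choose k) * x ^ k * y ^ (p - k)"
    if "k \<in> {0<..<p}" for k
  proof -
    have "p dvd p choose k"
      using that assms by (intro dvd_choose_prime) auto
    then have "(of_nat p :: 'a) dvd of_nat (p choose k)"
      by (auto elim!: dvdE)
    then show ?thesis
      by (intro dvd_mult2)
  qed
  ultimately show ?thesis
    by (auto simp: dcong_def intro: dvd_sum)
qed

lemma dcong_one_minus_power:
  fixes y :: "'a::comm_ring_1"
  assumes "prime p"
  shows "dcong (of_nat p) ((1 - y) ^ p ^ t) (1 - y ^ p ^ t)"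
proof (induction t)
  case (Suc t)
  define z where "z = y ^ p ^ t"
  have "dcong (of_nat p) (((1 - y) ^ p ^ t) ^ p) ((1 - z) ^ p)"
    unfolding z_def by (rule dcong_power) (rule Suc)
  \<comment> \<open>The binomial congruence for (1 - z) + z = 1 avoids the sign of (-z)^p.\<close>
  also have "dcong (of_nat p) ((1 - z) ^ p) (1 - z ^ p)"
    using dcong_sym[OF dcong_freshmans_dream[OF assms, of "1 - z" z]]
    by (simp add: dcong_def algebra_simps)
  finally show ?case
    by (simp add: z_def mult.commute flip: power_mult)
qed simp

text \<open>Modulo p, f is (X - a) g. At the other points x of \<open>A\<close> the factor x - a is
  invertible modulo p, so g vanishes there and the induction applies to g.\<close>

lemma lagrange_poly_mod_prime:
  fixes f :: "int poly"
  assumes "prime p" "finite A" "degree f < card A"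
    "\<And>x. x \<in> A \<Longrightarrow> p dvd poly f x"
    "\<And>x y. x \<in> A \<Longrightarrow> y \<in> A \<Longrightarrow> p dvd x - y \<Longrightarrow> x = y"
  shows "p dvd coeff f n"
  using assms(2-)
proof (induction A arbitrary: f n rule: finite_induct)
  case (insert a A)
  define g where "g = synthetic_div f a"
  have f: "f = [:-a, 1:] * g + [:poly f a:]"
    unfolding g_def by (rule synthetic_div_correct'[symmetric])
  have fa: "p dvd poly f a"
    using insert.prems(2) by simp
  have "p dvd coeff g n" for n
  proof (cases "degree f = 0")
    \<comment> \<open>For constant f the degree does not drop, so an empty \<open>A\<close> would
      block the induction hypothesis; but here g = 0.\<close>
    case True
    then show ?thesis
      by (simp add: g_def synthetic_div_eq_0_iff[THEN iffD2])
  next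
    case False
    show ?thesis
    proof (rule insert.IH)
      show "degree g < card A"
        using insert.prems(1) insert.hyps False by (simp add: g_def degree_synthetic_div)
    next
      fix x assume x: "x \<in> A"
      have "poly f x = (x - a) * poly g x + poly f a"
        by (subst f) (simp add: algebra_simps)
      moreover have "p dvd poly f x"
        using insert.prems(2) x by simp
      ultimately have "p dvd (x - a) * poly g x"
        using fa by (metis dvd_add_left_iff)
      moreover have "\<not> p dvd x - a"
        using insert.prems(3)[of x a] x insert.hyps by auto
      ultimately show "p dvd poly g x"
        using assms(1) prime_dvd_mult_iff by blast
    qed (use insert.prems(3) in auto)
  qed
  then have "p dvd coeff ([:-a, 1:] * g) n"
    by (simp add: coeff_pCons split: nat.split)
  then show ?case
    using fa by (subst f) (simp add: coeff_pCons split: nat.split)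
qed simp

lemma dcong_of_nat_power_prime:
  assumes "prime p"
  shows "dcong (of_nat p) (of_nat x ^ p) (of_nat x :: 'a::comm_ring_1)"
proof (induction x)
  case 0
  then show ?case using prime_gt_0_nat[OF assms] by (simp add: zero_power)
next
  case (Suc x)
  have "dcong (of_nat p) ((of_nat x + 1) ^ p) (of_nat x ^ p + 1 :: 'a)"
    using dcong_freshmans_dream[OF assms, of "of_nat x" "1::'a"] by simp
  also have "dcong (of_nat p) (of_nat x ^ p + 1) (of_nat x + 1 :: 'a)"
    using Suc by (simp add: dcong_def)
  finally show ?case
    by (simp add: add.commute)
qed

subsection \<open>The generating function of the Stirling numbers\<close>

definition stirling_denom :: "nat \<Rightarrow> int fps" where
  "stirling_denom k = (\<Prod>j=1..k. 1 - of_nat j * fps_X)"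

text \<open>The shift by k makes the constant coefficient S(k,k) = 1.\<close>

definition stirling_gf :: "nat \<Rightarrow> int fps" where
  "stirling_gf k = Abs_fps (\<lambda>n. int (Stirling (n + k) k))"

lemma stirling_denom_0 [simp]: "stirling_denom 0 = 1"
  by (simp add: stirling_denom_def)

lemma stirling_denom_Suc: "stirling_denom (Suc k) = stirling_denom k * (1 - of_nat (Suc k) * fps_X)"
  by (simp add: stirling_denom_def)

text \<open>Coefficient n is the recurrence for S(n+k+1,k+1); for n = 0 the term without a
  counterpart is S(k,k+1) = 0.\<close>

lemma stirling_gf_Suc: "stirling_gf (Suc k) * (1 - of_nat (Suc k) * fps_X) = stirling_gf k"
proof (rule fps_ext)
  fix n
  have "fps_nth (stirling_gf (Suc k) * (1 - of_nat (Suc k) * fps_X)) n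
      = fps_nth (stirling_gf (Suc k)) n - int (Suc k) * fps_nth (fps_X * stirling_gf (Suc k)) n"
    by (simp only: right_diff_distrib fps_sub_nth mult_1_right flip: fps_of_nat)
       (simp add: algebra_simps flip: fps_const_mult_left)
  also have "\<dots> = fps_nth (stirling_gf k) n"
    by (cases n) (simp_all add: stirling_gf_def algebra_simps)
  finally show "fps_nth (stirling_gf (Suc k) * (1 - of_nat (Suc k) * fps_X)) n = fps_nth (stirling_gf k) n" .
qed

lemma stirling_denom_mult_gf: "stirling_denom k * stirling_gf k = 1"
proof (induction k)
  case 0
  have "fps_nth (stirling_gf 0) n = fps_nth 1 n" for n
    by (cases n) (simp_all add: stirling_gf_def)
  then show ?case by (simp add: fps_eq_iff)
next
  case (Suc k)
  then show ?case
    by (simp add: stirling_denom_Suc mult.assoc mult.commute[of "1 - of_nat (Suc k) * fps_X"]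
        stirling_gf_Suc del: of_nat_Suc)
qed

section \<open>The denominators modulo a prime and its powers\<close>

lemma dcong_stirling_denom_add:
  "dcong (of_nat q) (stirling_denom (q + k)) (stirling_denom q * stirling_denom k)"
proof (induction k)
  case (Suc k)
  \<comment> \<open>Indices that differ by q give the same factor modulo q.\<close>
  have "dcong (of_nat q) (1 - of_nat (Suc (q + k)) * fps_X) (1 - of_nat (Suc k) * fps_X :: int fps)"
    by (simp add: dcong_def algebra_simps)
  with Suc show ?case
    by (simp only: add_Suc_right stirling_denom_Suc mult.assoc[symmetric]) (rule dcong_mult)
qed simp

lemma dcong_stirling_denom_mult_add:
  "dcong (of_nat q) (stirling_denom (q * l + k)) (stirling_denom q ^ l * stirling_denom k)"
proof (induction l)
  case (Suc l)
  have "dcong (of_nat q) (stirling_denom (q + (q * l + k)))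
      (stirling_denom q * stirling_denom (q * l + k))"
    by (rule dcong_stirling_denom_add)
  also have "dcong (of_nat q) (stirling_denom q * stirling_denom (q * l + k))
      (stirling_denom q * (stirling_denom q ^ l * stirling_denom k))"
    by (intro dcong_mult dcong_refl Suc)
  finally show ?case
    by (simp add: algebra_simps)
qed simp

text \<open>Up to the factor 1 - pX, which is 1 modulo p, both sides are polynomials of degree at
  most p - 1. They agree modulo p at all p residues, hence coefficientwise.\<close>

lemma dcong_stirling_denom_prime:
  assumes "prime p"
  shows "dcong (of_nat p) (stirling_denom p) (1 - fps_X ^ (p - 1))"
proof -
  have p: "p > 1" using assms by (rule prime_gt_1_nat)
  have ip: "prime (int p)" using assms by simp
  define h :: "int poly" where "h = (\<Prod>j=1..p-1. [:1, - int j:])"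
  \<comment> \<open>Including the root \<open>0\<close> gives \<open>p\<close> roots in degree \<open>p - 1\<close>, so Wilson's theorem is not needed.\<close>
  define f where "f = h - (1 - monom 1 (p - 1))"
  have "degree h \<le> (\<Sum>j=1..p-1. degree [:1, - int j:])"
    unfolding h_def by (rule order_trans[OF degree_prod_sum_le]) auto
  also have "\<dots> \<le> (\<Sum>j=1..p-1. 1)"
    by (intro sum_mono) auto
  finally have "degree f \<le> p - 1"
    unfolding f_def by (intro degree_diff_le) (auto simp: degree_monom_eq)
  moreover have "int p dvd poly f x" if x: "x \<in> {0..<int p}" for x
  proof (cases "x = 0")
    case True
    then show ?thesis
      using p by (simp add: f_def h_def poly_prod poly_monom power_0_left)
  next
    case False
    then have "\<not> int p dvd x"
      using x zdvd_not_zless[of x "int p"] by auto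
    have "int p dvd int (nat x) ^ p - int (nat x)"
      using dcong_of_nat_power_prime[OF assms, of "nat x", where 'a = int]
      by (simp add: dcong_def)
    also have "int (nat x) ^ p - int (nat x) = x * (x ^ (p - 1) - 1)"
      using x p by (simp add: algebra_simps flip: power_Suc)
    finally have fermat: "int p dvd x ^ (p - 1) - 1"
      using \<open>\<not> int p dvd x\<close> ip prime_dvd_mult_iff by blast
    \<comment> \<open>x is a root of \<open>h\<close> modulo p: for j inverse to x, the factor 1 -
      jX vanishes at x.\<close>
    have "coprime x (int p)"
      using \<open>\<not> int p dvd x\<close> ip prime_imp_coprime coprime_commute by blast
    then obtain y where y: "[x * y = 1] (mod int p)"
      using cong_solve_coprime_int by blast
    define j where "j = nat (y mod int p)"
    have j: "int j = y mod int p"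
      using p by (simp add: j_def)
    have "[x * int j = 1] (mod int p)"
      using y unfolding j by (simp add: cong_def mod_mult_right_eq)
    then have jdvd: "int p dvd poly [:1, - int j:] x"
      by (simp add: cong_iff_dvd_diff dvd_diff_commute)
    have "j \<noteq> 0"
      using jdvd p by (auto intro!: Nat.gr0I)
    moreover have "j < p"
      using j p by (metis of_nat_0_less_iff of_nat_less_iff pos_mod_bound order_less_trans zero_less_one)
    ultimately have "poly [:1, - int j:] x dvd poly h x"
      unfolding h_def poly_prod by (intro dvd_prodI) auto
    then have "int p dvd poly h x"
      using jdvd dvd_trans by blast
    then have "int p dvd poly h x + (x ^ (p - 1) - 1)"
      using fermat by (rule dvd_add)
    moreover have "poly f x = poly h x + (x ^ (p - 1) - 1)"
      by (simp add: f_def poly_monom)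
    ultimately show ?thesis
      by (simp only:)
  qed
  moreover have "x = y" if "x \<in> {0..<int p}" "y \<in> {0..<int p}" "int p dvd x - y" for x y
    using that by (auto simp: mod_eq_dvd_iff[symmetric])
  ultimately have "int p dvd coeff f n" for n
    using p ip by (intro lagrange_poly_mod_prime[where A = "{0..<int p}"]) auto
  then have "fps_of_poly f = fps_const (of_nat p) * Abs_fps (\<lambda>n. coeff f n div int p)"
    by (simp add: fps_eq_iff)
  moreover have "fps_of_poly f = stirling_denom (p - 1) - (1 - fps_X ^ (p - 1))"
  proof -
    have "fps_of_poly [:1, - int j:] = 1 - of_nat j * fps_X" for j
    proof -
      have "[:1, - int j:] = 1 - [:int j:] * [:0, 1:]"
        by (simp add: one_pCons)
      then show ?thesis
        using fps_of_nat[of j, where 'a = int]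
        by (simp only: fps_of_poly_diff fps_of_poly_mult fps_of_poly_const fps_of_poly_fps_X fps_of_poly_1)
    qed
    then show ?thesis
      by (simp add: f_def h_def stirling_denom_def fps_of_poly_diff fps_of_poly_prod fps_of_poly_monom)
  qed
  ultimately have "dcong (of_nat p) (stirling_denom (p - 1)) (1 - fps_X ^ (p - 1))"
    by (simp add: dcong_def fps_of_nat)
  moreover have "dcong (of_nat p) (stirling_denom p) (stirling_denom (p - 1))"
  proof -
    have "stirling_denom p = stirling_denom (p - 1) * (1 - of_nat p * fps_X)"
      using stirling_denom_Suc[of "p - 1"] p by simp
    then have "stirling_denom p - stirling_denom (p - 1) = of_nat p * (- (fps_X * stirling_denom (p - 1)))"
      by (simp add: algebra_simps)
    then show ?thesis
      unfolding dcong_def by (metis dvd_triv_left)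
  qed
  ultimately show ?thesis
    by (blast intro: dcong_trans)
qed

text \<open>Since p^e = p^N p^(e-N), the left side is a p^(e-N)-th power modulo p^N. Its base is
  first known modulo p only, and the power lifts the modulus.\<close>

lemma dcong_stirling_denom_prime_power:
  assumes "prime p" "N > 0" "2 * N \<le> Suc e"
  shows "dcong (of_nat (p ^ N)) (stirling_denom (p ^ e))
    ((1 - fps_X ^ ((p - 1) * p ^ (e - N))) ^ p ^ (N - 1))"
proof -
  let ?Y = "fps_X ^ (p - 1) :: int fps"
  have e: "e \<ge> N" using assms by linarith
  have "p * p ^ (N - 1) = p ^ N"
    using \<open>N > 0\<close> by (cases N) auto
  then have "dcong (of_nat p) (stirling_denom (p ^ N)) (stirling_denom p ^ p ^ (N - 1))"
    using dcong_stirling_denom_mult_add[of p "p ^ (N - 1)" 0] by simp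
  also have "dcong (of_nat p) \<dots> ((1 - ?Y) ^ p ^ (N - 1))"
    using assms(1) by (intro dcong_power dcong_stirling_denom_prime)
  finally have *: "dcong (of_nat p ^ Suc (e - N)) (stirling_denom (p ^ N) ^ p ^ (e - N))
      (((1 - ?Y) ^ p ^ (N - 1)) ^ p ^ (e - N))"
    by (rule dcong_power_lift)
  have "dcong (of_nat (p ^ N)) (stirling_denom (p ^ e)) (stirling_denom (p ^ N) ^ p ^ (e - N))"
    using dcong_stirling_denom_mult_add[of "p ^ N" "p ^ (e - N)" 0] e by (simp flip: power_add)
  \<comment> \<open>Lifting gives the modulus p^(e-N+1), divisible by p^N because 2N <= e+1.\<close>
  also have "dcong (of_nat (p ^ N)) \<dots> (((1 - ?Y) ^ p ^ (N - 1)) ^ p ^ (e - N))"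
    using assms(3) e by (intro dcong_dvd_modulus[OF *]) (simp add: le_imp_power_dvd del: power_Suc)
  \<comment> \<open>After the swap, the inner exponent p^(e-N) passes to Y modulo p, and the outer
    p^(N-1) lifts that congruence to p^N.\<close>
  also have "\<dots> = ((1 - ?Y) ^ p ^ (e - N)) ^ p ^ (N - 1)"
    by (simp add: mult.commute flip: power_mult)
  also have "dcong (of_nat (p ^ N)) \<dots> ((1 - ?Y ^ p ^ (e - N)) ^ p ^ (N - 1))"
    using dcong_power_lift[OF dcong_one_minus_power[OF assms(1), of ?Y "e - N"], of "N - 1"] \<open>N > 0\<close>
    by simp
  finally show ?thesis
    by (simp flip: power_mult)
qed

subsection \<open>Coefficients of powers of the geometric series\<close>

definition geom_fps :: "int fps" where
  "geom_fps = Abs_fps (\<lambda>_. 1)"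

lemma one_minus_X_mult_geom_fps: "(1 - fps_X) * geom_fps = 1"
proof (rule fps_ext)
  show "fps_nth ((1 - fps_X) * geom_fps) n = fps_nth 1 n" for n
    by (cases n) (simp_all add: geom_fps_def left_diff_distrib)
qed

text \<open>Substituting X^T into (1 - X) * \<open>geom_fps\<close> = 1 respects products, as T > 0
  makes the constant coefficient of X^T vanish.\<close>

lemma one_minus_X_power_mult_geom_fps_compose:
  assumes "T > 0"
  shows "(1 - fps_X ^ T) ^ r * (geom_fps ^ r oo fps_X ^ T) = 1"
proof -
  have T: "fps_nth (fps_X ^ T :: int fps) 0 = 0"
    using assms by simp
  have "((1 - fps_X) * geom_fps) oo fps_X ^ T = 1"
    by (simp add: one_minus_X_mult_geom_fps)
  then have "(1 - fps_X ^ T) * (geom_fps oo fps_X ^ T) = 1"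
    using T by (simp add: fps_compose_mult_distrib fps_compose_sub_distrib)
  then have "((1 - fps_X ^ T) * (geom_fps oo fps_X ^ T)) ^ r = 1"
    by simp
  then show ?thesis
    using T by (simp add: power_mult_distrib fps_compose_power)
qed

lemma fps_nth_compose_X_power:
  fixes F :: "'a::comm_ring_1 fps"
  assumes "T > 0"
  shows "fps_nth (F oo fps_X ^ T) n = (if T dvd n then fps_nth F (n div T) else 0)"
proof -
  have "fps_nth (F oo fps_X ^ T) n = (\<Sum>i\<in>{0..n}. if n = T * i then fps_nth F i else 0)"
    by (simp add: fps_compose_nth if_distrib cong: if_cong flip: power_mult)
  also have "\<dots> = (if T dvd n then fps_nth F (n div T) else 0)"
  proof (cases "T dvd n")
    case True
    define k where "k = n div T"
    have "n = T * k" using True by (simp add: k_def)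
    then have "k \<le> n" "\<And>i. n = T * i \<longleftrightarrow> i = k" "n div T = k" using assms by auto
    then show ?thesis using True by simp
  qed (auto intro!: sum.neutral)
  finally show ?thesis .
qed

text \<open>The value 0 at negative indices lets sums over j keep a fixed range.\<close>

definition fps_nth_int :: "'a::zero fps \<Rightarrow> int \<Rightarrow> 'a" where
  "fps_nth_int F z = (if z < 0 then 0 else fps_nth F (nat z))"

text \<open>Only multiples of T contribute to the convolution. Terms beyond its range have a
  negative index in H and are 0, so one J can serve all e.\<close>

lemma fps_nth_int_compose_X_power_mult:
  fixes F H :: "int fps"
  assumes T: "T > 0" and J: "z \<le> int T * int J"
  shows "fps_nth_int ((F oo fps_X ^ T) * H) z
    = (\<Sum>j\<le>J. fps_nth F j * fps_nth_int H (z - int T * int j))"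
proof (cases "z < 0")
  case True
  then have "z - int T * int j < 0" for j
    using T by (smt (verit) mult_nonneg_nonneg of_nat_0_le_iff)
  then show ?thesis
    using True by (simp add: fps_nth_int_def)
next
  case False
  define n where "n = nat z"
  have z: "z = int n" using False by (simp add: n_def)
  have le: "z - int T * int j < 0 \<longleftrightarrow> \<not> T * j \<le> n" for j
    unfolding z by (simp add: not_le flip: of_nat_mult)
  have "fps_nth_int ((F oo fps_X ^ T) * H) z
      = (\<Sum>i\<in>{0..n}. (if T dvd i then fps_nth F (i div T) else 0) * fps_nth H (n - i))"
    using False by (simp add: fps_nth_int_def n_def fps_mult_nth fps_nth_compose_X_power[OF T])
  also have "\<dots> = (\<Sum>i\<in>{i\<in>{0..n}. T dvd i}. fps_nth F (i div T) * fps_nth H (n - i))"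
    by (rule sum.mono_neutral_cong_right) auto
  also have "\<dots> = (\<Sum>j\<in>{j\<in>{..J}. T * j \<le> n}. fps_nth F j * fps_nth H (n - T * j))"
  proof (rule sum.reindex_bij_witness[where i = "\<lambda>j. T * j" and j = "\<lambda>i. i div T"])
    fix i assume i: "i \<in> {i\<in>{0..n}. T dvd i}"
    have "int i \<le> int T * int J" using i J z by auto
    then have "i \<le> T * J" by (metis of_nat_le_iff of_nat_mult)
    then have "i div T \<le> J"
      using T by (metis div_le_mono nonzero_mult_div_cancel_left less_not_refl)
    then show "i div T \<in> {j\<in>{..J}. T * j \<le> n}"
      using i by auto
  qed (use T in auto)
  also have "\<dots> = (\<Sum>j\<le>J. fps_nth F j * fps_nth_int H (z - int T * int j))"
  proof (rule sum.mono_neutral_cong_left)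
    fix j assume j: "j \<in> {j\<in>{..J}. T * j \<le> n}"
    then have "nat (z - int T * int j) = n - T * j"
      unfolding z by (simp flip: of_nat_mult of_nat_diff)
    then show "fps_nth F j * fps_nth H (n - T * j)
        = fps_nth F j * fps_nth_int H (z - int T * int j)"
      using j le[of j] by (simp add: fps_nth_int_def)
  qed (use le in \<open>auto simp: fps_nth_int_def\<close>)
  finally show ?thesis .
qed

section \<open>Congruences between coefficients and their periods\<close>

lemma cong_fps_nth_int:
  assumes "dcong (of_nat q) F G"
  shows "[fps_nth_int F z = fps_nth_int G z] (mod int q)"
proof -
  obtain K where "F - G = of_nat q * K"
    using assms by (auto simp: dcong_def)
  then have "fps_nth F n - fps_nth G n = int q * fps_nth K n" for n
    by (metis fps_mult_left_const_nth fps_of_nat fps_sub_nth)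
  then show ?thesis
    by (auto simp: fps_nth_int_def cong_iff_dvd_diff)
qed

text \<open>Applied with t = q it turns constant increments into a period; with D = 0 it passes to
  multiples of a period.\<close>

lemma cong_add_mult_of_cong_diff:
  fixes s :: "nat \<Rightarrow> int"
  assumes "\<And>n. [s (n + L) = s n + D] (mod q)"
  shows "[s (n + t * L) = s n + int t * D] (mod q)"
proof (induction t)
  case (Suc t)
  have "[s ((n + t * L) + L) = s (n + t * L) + D] (mod q)"
    by (rule assms)
  also have "[s (n + t * L) + D = (s n + int t * D) + D] (mod q)"
    by (intro cong_add Suc cong_refl)
  finally show ?case
    by (simp add: algebra_simps)
qed simp

text \<open>The coefficients of each power are the partial sums of those of the power before. If L
  is a period of the latter modulo q, the increment over L is constant modulo q, so q such steps add
  0.\<close>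

lemma geom_fps_power_periodic:
  "[fps_nth (geom_fps ^ Suc r) (n + q ^ r) = fps_nth (geom_fps ^ Suc r) n] (mod int q)"
proof (induction r arbitrary: n)
  case 0
  then show ?case by (simp add: geom_fps_def)
next
  case (Suc r)
  note per = Suc.IH
  define f s where "f = fps_nth (geom_fps ^ Suc r)" and "s = fps_nth (geom_fps ^ Suc (Suc r))"
  define L where "L = q ^ r"
  have "(1 - fps_X) * geom_fps ^ Suc (Suc r) = geom_fps ^ Suc r"
    unfolding power_Suc[of _ "Suc r"] mult.assoc[symmetric] one_minus_X_mult_geom_fps by simp
  then have "fps_nth ((1 - fps_X) * geom_fps ^ Suc (Suc r)) (Suc n) = f (Suc n)" for n
    by (simp only: f_def)
  then have s: "s (Suc n) = s n + f (Suc n)" for n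
    by (simp add: s_def left_diff_distrib algebra_simps del: power_Suc)
  have "[s (n + L) = s n + (s L - s 0)] (mod int q)" for n
  proof (induction n)
    case (Suc n)
    have "[s (n + L) + f (Suc n + L) = s n + (s L - s 0) + f (Suc n)] (mod int q)"
      using Suc.IH per[of "Suc n"] unfolding f_def L_def by (rule cong_add)
    then show ?case
      by (simp add: s algebra_simps)
  qed simp
  then have "[s (n + q * L) = s n + int q * (s L - s 0)] (mod int q)"
    by (rule cong_add_mult_of_cong_diff)
  then have "[s (n + q * L) = s n] (mod int q)"
    by (simp add: cong_def)
  moreover have "q ^ Suc r = q * L"
    by (simp add: L_def)
  ultimately show ?case
    unfolding s_def by (simp only:)
qed

lemma geom_fps_power_compose_periodic:
  assumes "T > 0"
  shows "[fps_nth (geom_fps ^ Suc r oo fps_X ^ T) (n + T * q ^ r)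
    = fps_nth (geom_fps ^ Suc r oo fps_X ^ T) n] (mod int q)"
proof (cases "T dvd n")
  case True
  then obtain k where n: "n = T * k" ..
  have "n + T * q ^ r = T * (k + q ^ r)"
    by (simp add: n algebra_simps)
  then show ?thesis
    using geom_fps_power_periodic[of r k q] assms
    by (simp add: n fps_nth_compose_X_power[OF assms] del: power_Suc)
next
  case False
  then have "\<not> T dvd n + T * q ^ r"
    by (simp add: dvd_add_left_iff)
  with False show ?thesis
    by (simp add: fps_nth_compose_X_power[OF assms] del: power_Suc)
qed

lemma cong_periodic_dvd:
  fixes f :: "nat \<Rightarrow> int"
  assumes "\<And>n. [f (n + L) = f n] (mod q)" "L dvd k"
  shows "[f (n + k) = f n] (mod q)"
proof -
  obtain t where "k = t * L"
    using assms(2) by (metis dvd_def mult.commute)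
  then show ?thesis
    using cong_add_mult_of_cong_diff[of f L 0 q n t] assms(1) by simp
qed

subsection \<open>Sequences that are eventually constant modulo an integer\<close>

definition eventually_const_mod :: "int \<Rightarrow> (nat \<Rightarrow> int) \<Rightarrow> bool" where
  "eventually_const_mod q u \<longleftrightarrow> (\<exists>r. \<forall>\<^sub>F e in sequentially. [u e = r] (mod q))"

lemma eventually_const_mod_const: "eventually_const_mod q (\<lambda>_. r)"
  unfolding eventually_const_mod_def by (intro exI[of _ r]) simp

lemma eventually_const_mod_diff:
  assumes "eventually_const_mod q u" "eventually_const_mod q v"
  shows "eventually_const_mod q (\<lambda>e. u e - v e)"
proof -
  obtain r s where "\<forall>\<^sub>F e in sequentially. [u e = r] (mod q)" "\<forall>\<^sub>F e in sequentially. [v e = s] (mod q)"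
    using assms by (auto simp: eventually_const_mod_def)
  then have "\<forall>\<^sub>F e in sequentially. [u e - v e = r - s] (mod q)"
    by eventually_elim (rule cong_diff)
  then show ?thesis by (auto simp: eventually_const_mod_def)
qed

lemma eventually_const_mod_mult:
  assumes "eventually_const_mod q u" "eventually_const_mod q v"
  shows "eventually_const_mod q (\<lambda>e. u e * v e)"
proof -
  obtain r s where "\<forall>\<^sub>F e in sequentially. [u e = r] (mod q)" "\<forall>\<^sub>F e in sequentially. [v e = s] (mod q)"
    using assms by (auto simp: eventually_const_mod_def)
  then have "\<forall>\<^sub>F e in sequentially. [u e * v e = r * s] (mod q)"
    by eventually_elim (rule cong_mult)
  then show ?thesis by (auto simp: eventually_const_mod_def)
qed

lemma eventually_const_mod_sum:
  assumes "finite A" "\<And>j. j \<in> A \<Longrightarrow> eventually_const_mod q (u j)"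
  shows "eventually_const_mod q (\<lambda>e. \<Sum>j\<in>A. u j e)"
proof -
  obtain r where "\<And>j. j \<in> A \<Longrightarrow> \<forall>\<^sub>F e in sequentially. [u j e = r j] (mod q)"
    using assms(2) unfolding eventually_const_mod_def by metis
  then have "\<forall>\<^sub>F e in sequentially. \<forall>j\<in>A. [u j e = r j] (mod q)"
    using assms(1) by (simp add: eventually_ball_finite)
  then have "\<forall>\<^sub>F e in sequentially. [(\<Sum>j\<in>A. u j e) = (\<Sum>j\<in>A. r j)] (mod q)"
    by eventually_elim (auto intro: cong_sum)
  then show ?thesis by (auto simp: eventually_const_mod_def)
qed

lemma eventually_const_mod_cong:
  assumes "eventually_const_mod q u" "\<forall>\<^sub>F e in sequentially. [v e = u e] (mod q)"
  shows "eventually_const_mod q v"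
proof -
  obtain r where "\<forall>\<^sub>F e in sequentially. [u e = r] (mod q)"
    using assms by (auto simp: eventually_const_mod_def)
  with assms(2) have "\<forall>\<^sub>F e in sequentially. [v e = r] (mod q)"
    by eventually_elim (rule cong_trans)
  then show ?thesis by (auto simp: eventually_const_mod_def)
qed

lemma eventually_const_modI:
  assumes "\<And>e. e \<ge> e0 \<Longrightarrow> [u (Suc e) = u e] (mod q)"
  shows "eventually_const_mod q u"
proof -
  have "[u e = u e0] (mod q)" if "e \<ge> e0" for e
    using that
  proof (induction e rule: dec_induct)
    case (step e)
    then show ?case using assms[of e] by (blast intro: cong_trans)
  qed simp
  then show ?thesis
    unfolding eventually_const_mod_def eventually_sequentially by blast
qed

lemma power_gt_self_int: "p > 1 \<Longrightarrow> int n < int p ^ n"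
  using power_gt_expt[of p n] by (simp flip: of_nat_power)

text \<open>The sign of \<alpha> decides: for \<alpha> < 0 the index becomes negative, for \<alpha>
  = 0 it is constant, and for \<alpha> > 0 it grows by multiples of the period.\<close>

lemma eventually_const_mod_periodic:
  fixes H :: "int fps" and \<alpha> \<beta> :: int
  assumes p: "p > 1"
    and per: "\<And>n. [fps_nth H (n + (p - 1) * p ^ R) = fps_nth H n] (mod q)"
  shows "eventually_const_mod q (\<lambda>e. fps_nth_int H (int p ^ (e - N) * \<alpha> + \<beta>))"
proof -
  \<comment> \<open>This makes p^R divide p^(e-N), and |\<beta>| <= e-N < p^(e-N) keeps \<beta> from
    changing the sign.\<close>
  define e0 where "e0 = N + R + nat \<bar>\<beta>\<bar>"
  have big: "\<bar>\<beta>\<bar> < int p ^ (e - N)" if "e \<ge> e0" for e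
  proof -
    have "\<bar>\<beta>\<bar> \<le> int (e - N)" using that by (simp add: e0_def)
    then show ?thesis using power_gt_self_int[OF p, of "e - N"] by linarith
  qed
  have step: "int p ^ (Suc e - N) * \<alpha> + \<beta> = int p ^ (e - N) * \<alpha> + \<beta> + int (p - 1) * int p ^ (e - N) * \<alpha>"
    if "e \<ge> e0" for e
    using that p by (simp add: e0_def Suc_diff_le of_nat_diff algebra_simps)
  consider "\<alpha> < 0" | "\<alpha> = 0" | "\<alpha> > 0" by linarith
  then show ?thesis
  proof cases
    case 1
    have "fps_nth_int H (int p ^ (e - N) * \<alpha> + \<beta>) = 0" if "e \<ge> e0" for e
    proof -
      have "int p ^ (e - N) * \<alpha> \<le> int p ^ (e - N) * (- 1)"
        using 1 by (intro mult_left_mono) auto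
      then show ?thesis using big[OF that] by (simp add: fps_nth_int_def)
    qed
    then show ?thesis
      by (intro eventually_const_modI[of e0]) auto
  next
    case 2
    then show ?thesis by (simp add: eventually_const_mod_const)
  next
    case 3
    show ?thesis
    proof (rule eventually_const_modI[of e0])
      fix e assume e: "e \<ge> e0"
      define z where "z = int p ^ (e - N) * \<alpha> + \<beta>"
      define k where "k = (p - 1) * p ^ (e - N) * nat \<alpha>"
      have "int p ^ (e - N) * 1 \<le> int p ^ (e - N) * \<alpha>"
        using 3 by (intro mult_left_mono) auto
      then have z: "z \<ge> 0"
        using big[OF e] by (simp add: z_def)
      have k: "int k = int (p - 1) * int p ^ (e - N) * \<alpha>"
        using 3 by (simp add: k_def)
      have "(p - 1) * p ^ R dvd k"
        unfolding k_def using e by (intro dvd_mult2 mult_dvd_mono le_imp_power_dvd) (auto simp: e0_def)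
      then have "[fps_nth H (nat z + k) = fps_nth H (nat z)] (mod q)"
        by (rule cong_periodic_dvd[of "fps_nth H", OF per])
      moreover have "nat (z + int k) = nat z + k"
        using z by (simp add: nat_add_distrib)
      ultimately show "[fps_nth_int H (int p ^ (Suc e - N) * \<alpha> + \<beta>)
          = fps_nth_int H (int p ^ (e - N) * \<alpha> + \<beta>)] (mod q)"
        using z unfolding step[OF e] k[symmetric] z_def[symmetric] by (simp add: fps_nth_int_def)
    qed
  qed
qed

subsection \<open>Convergence of the Stirling numbers\<close>

text \<open>The second argument is nonnegative, so numbers of the first kind do not enter; for n < k
  both sides are 0.\<close>

lemma Stirling_int_eq_fps_nth_int:
  "Stirling_int n (int k) = fps_nth_int (stirling_gf k) (n - int k)"
proof (cases "n < int k")
  case True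
  then show ?thesis
    by (auto simp: Stirling_int_def fps_nth_int_def nat_less_iff intro: Stirling_less)
next
  case False
  then have "nat (n - int k) + k = nat n" by simp
  with False show ?thesis
    by (simp add: Stirling_int_def fps_nth_int_def stirling_gf_def)
qed

lemma eventually_const_mod_Stirling_int_base:
  fixes a b c :: int
  assumes p: "prime p" and N: "N > 0" "2 * N \<le> Suc M" and ab: "0 \<le> b" "b \<le> a"
  shows "eventually_const_mod (int p ^ N)
    (\<lambda>e. Stirling_int (int p ^ e * a + c) (int p ^ e * b + int p ^ M))"
proof -
  have p1: "p > 1" using p by (rule prime_gt_1_nat)
  define Q T where "Q = p ^ (N - 1)" and "T e = (p - 1) * p ^ (e - N)" for e
  have T: "T e > 0" for e using p1 by (simp add: T_def)
  \<comment> \<open>\<open>F\<close> comes from the b copies of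
    \<open>stirling_denom (p ^ e)\<close>, with e left only in \<open>T e\<close>; \<open>H\<close>
    comes from \<open>stirling_denom (p ^ M)\<close>.\<close>
  define F where "F = geom_fps ^ (Q * nat b)"
  define H where "H = (geom_fps ^ Q oo fps_X ^ T M)"
  \<comment> \<open>Chosen for z <= p^e (a-b+1) = p^(e-N) J <= T(e) J, uniformly in e.\<close>
  define J where "J = p ^ N * nat (a - b + 1)"
  \<comment> \<open>\<alpha> is what remains of p^e (a-b) - T(e) j after taking out p^(e-N).\<close>
  define \<alpha> where "\<alpha> j = int p ^ N * (a - b) - int (p - 1) * int j" for j
  define \<beta> where "\<beta> = c - int p ^ M"
  \<comment> \<open>2N serves the congruence for \<open>stirling_denom (p ^ e)\<close>; the rest
    gives |\<beta>| <= e < p^e.\<close>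
  define e0 where "e0 = 2 * N + nat \<bar>\<beta>\<bar>"
  have ab': "int (nat b) = b" "int (nat (a - b + 1)) = a - b + 1"
    using ab by simp_all
  have "Q > 0" using p1 by (simp add: Q_def)
  then obtain Q' where Q': "Q = Suc Q'" by (metis gr0_implies_Suc)
  \<comment> \<open>The period of \<open>H\<close> modulo p^N, brought to the form (p-1)
    p^R.\<close>
  have L: "(p - 1) * p ^ (M - N + N * Q') = T M * (p ^ N) ^ Q'"
    by (simp add: T_def power_add power_mult)
  have per: "[fps_nth H (n + (p - 1) * p ^ (M - N + N * Q')) = fps_nth H n] (mod int p ^ N)" for n
    using geom_fps_power_compose_periodic[OF T, of Q' M n "p ^ N"]
    unfolding H_def Q' L of_nat_power .
  have "[Stirling_int (int p ^ e * a + c) (int p ^ e * b + int p ^ M)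
      = (\<Sum>j\<le>J. fps_nth F j * fps_nth_int H (int p ^ (e - N) * \<alpha> j + \<beta>))] (mod int p ^ N)"
    if e: "e \<ge> e0" for e
  proof -
    have eN: "2 * N \<le> Suc e" "N \<le> e" using e by (simp_all add: e0_def)
    have pe: "int p ^ e = int p ^ (e - N) * int p ^ N"
      using eN by (simp flip: power_add)
    define k where "k = p ^ e * nat b + p ^ M"
    define z where "z = int p ^ e * (a - b) + \<beta>"
    have k: "int k = int p ^ e * b + int p ^ M"
      using ab' by (simp add: k_def)
    have "dcong (of_nat (p ^ N)) (stirling_denom k) (stirling_denom (p ^ e) ^ nat b * stirling_denom (p ^ M))"
      unfolding k_def using eN
      by (intro dcong_dvd_modulus[OF dcong_stirling_denom_mult_add]) (simp add: le_imp_power_dvd)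
    also have "dcong (of_nat (p ^ N)) \<dots> (((1 - fps_X ^ T e) ^ Q) ^ nat b * (1 - fps_X ^ T M) ^ Q)"
      unfolding T_def Q_def using p N eN
      by (intro dcong_mult dcong_power dcong_stirling_denom_prime_power)
    finally have "dcong (of_nat (p ^ N)) (stirling_denom k) ((1 - fps_X ^ T e) ^ (Q * nat b) * (1 - fps_X ^ T M) ^ Q)"
      by (simp add: power_mult)
    moreover have "(1 - fps_X ^ T e) ^ (Q * nat b) * (1 - fps_X ^ T M) ^ Q * ((F oo fps_X ^ T e) * H) = 1"
    proof -
      have unit: "x * y * (u * v) = 1" if "x * u = 1" "y * v = 1" for x y u v :: "int fps"
      proof -
        have "x * y * (u * v) = (x * u) * (y * v)" by (simp only: mult_ac)
        then show ?thesis using that by simp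
      qed
      show ?thesis
        unfolding F_def H_def by (intro unit one_minus_X_power_mult_geom_fps_compose T)
    qed
    ultimately have "dcong (of_nat (p ^ N)) (stirling_gf k) ((F oo fps_X ^ T e) * H)"
      using stirling_denom_mult_gf by (blast intro: dcong_inverse)
    then have "[fps_nth_int (stirling_gf k) z = fps_nth_int ((F oo fps_X ^ T e) * H) z] (mod int p ^ N)"
      using cong_fps_nth_int by (metis of_nat_power)
    moreover have "fps_nth_int ((F oo fps_X ^ T e) * H) z
        = (\<Sum>j\<le>J. fps_nth F j * fps_nth_int H (z - int (T e) * int j))"
    proof (rule fps_nth_int_compose_X_power_mult[OF T])
      have "\<bar>\<beta>\<bar> \<le> int e" using e by (simp add: e0_def)
      then have "\<bar>\<beta>\<bar> \<le> int p ^ e" using power_gt_self_int[OF p1, of e] by linarith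
      then have "z \<le> int p ^ e * (a - b + 1)"
        by (simp add: z_def algebra_simps)
      also have "\<dots> = int (p ^ (e - N)) * int J"
        unfolding J_def pe of_nat_mult of_nat_power ab'(2) by (rule mult.assoc)
      also have "\<dots> \<le> int (T e) * int J"
        using p1 by (intro mult_right_mono) (simp_all add: T_def)
      finally show "z \<le> int (T e) * int J" .
    qed
    moreover have "z - int (T e) * int j = int p ^ (e - N) * \<alpha> j + \<beta>" for j
      unfolding z_def T_def \<alpha>_def pe of_nat_mult of_nat_power by (simp add: algebra_simps)
    moreover have "Stirling_int (int p ^ e * a + c) (int p ^ e * b + int p ^ M) = fps_nth_int (stirling_gf k) z"
      unfolding k[symmetric] Stirling_int_eq_fps_nth_int
      by (simp add: k z_def \<beta>_def algebra_simps)
    ultimately show ?thesis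
      by simp
  qed
  then have ev: "\<forall>\<^sub>F e in sequentially. [Stirling_int (int p ^ e * a + c) (int p ^ e * b + int p ^ M)
      = (\<Sum>j\<le>J. fps_nth F j * fps_nth_int H (int p ^ (e - N) * \<alpha> j + \<beta>))] (mod int p ^ N)"
    unfolding eventually_sequentially by blast
  show ?thesis
    by (rule eventually_const_mod_cong[OF _ ev])
       (intro eventually_const_mod_sum eventually_const_mod_mult eventually_const_mod_const
         eventually_const_mod_periodic[OF p1 per] finite_atMost)
qed

lemma eventually_const_mod_Stirling_int:
  fixes a b c d :: int
  assumes p: "prime p" and ab: "0 \<le> b" "b \<le> a"
  shows "eventually_const_mod (int p ^ N) (\<lambda>e. Stirling_int (int p ^ e * a + c) (int p ^ e * b + d))"
proof (cases "N = 0")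
  case True
  then show ?thesis
    by (auto simp: eventually_const_mod_def)
next
  case False
  have p1: "p > 1" using p by (rule prime_gt_1_nat)
  \<comment> \<open>2N meets the condition of the base case; the summand \<open>nat d\<close> puts d
    below p^M.\<close>
  define M where "M = 2 * N + nat d"
  have "d \<le> int M" by (simp add: M_def)
  then have "d \<le> int p ^ M"
    using power_gt_self_int[OF p1, of M] by linarith
  \<comment> \<open>Descent from p^M to d, for all c at once, since the recurrence uses both c and
    c+1.\<close>
  then show ?thesis
  proof (induction d arbitrary: c rule: int_le_induct)
    case base
    show ?case
      using False by (intro eventually_const_mod_Stirling_int_base p ab) (auto simp: M_def)
  next
    case (step d)
    \<comment> \<open>The multiplier in the recurrence settles at d, as p^e is 0 modulo p^N from e =
      N on.\<close>
    have k: "eventually_const_mod (int p ^ N) (\<lambda>e. int p ^ e * b + d)"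
    proof (rule eventually_const_modI[of N])
      fix e assume "e \<ge> N"
      then have "int p ^ N dvd int p ^ e"
        by (rule le_imp_power_dvd)
      then have "[int p ^ e = 0] (mod int p ^ N)" "[int p ^ Suc e = 0] (mod int p ^ N)"
        by (auto simp: cong_0_iff)
      then have "[int p ^ Suc e = int p ^ e] (mod int p ^ N)"
        by (metis cong_sym cong_trans)
      then show "[int p ^ Suc e * b + d = int p ^ e * b + d] (mod int p ^ N)"
        by (intro cong_add cong_mult cong_refl)
    qed
    have "Stirling_int (int p ^ e * a + c) (int p ^ e * b + (d - 1))
        = Stirling_int (int p ^ e * a + (c + 1)) (int p ^ e * b + d)
          - (int p ^ e * b + d) * Stirling_int (int p ^ e * a + c) (int p ^ e * b + d)" for e
      using Stirling_int_rec[of "int p ^ e * a + (c + 1)" "int p ^ e * b + d"]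
      by (simp add: algebra_simps)
    then show ?case
      using eventually_const_mod_diff[OF step.IH[of "c + 1"] eventually_const_mod_mult[OF k step.IH[of c]]]
      by simp
  qed
qed

section \<open>From eventual residues to the p-adic limit\<close>

lemma padic_convergent_if_eventually_const_mod:
  assumes p: "prime p" and u: "\<And>N. eventually_const_mod (int p ^ N) u"
  shows "\<exists>L \<in> padic_ints p. limitin (padic_topology p) (\<lambda>e. padic_of_int p (u e)) L sequentially"
proof -
  have mem: "padic_of_int p (u e) \<in> padic_ints p" for e
    using p by (intro padic_of_int_in_padic_ints prime_gt_0_nat)
  obtain r where r: "\<And>N. \<forall>\<^sub>F e in sequentially. [u e = r N] (mod int p ^ N)"
    using u unfolding eventually_const_mod_def by metis
  define L where "L N = r N mod int p ^ N" for N
  have ev: "\<forall>\<^sub>F e in sequentially. padic_of_int p (u e) N = L N" for N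
    using r[of N] by (simp add: padic_of_int_def L_def cong_def)
  have "L N \<in> {0..<int p ^ N} \<and> L (Suc N) mod int p ^ N = L N" for N
  proof -
    \<comment> \<open>The residues are coherent because a single e realizes both of them, and
      \<open>padic_of_int p (u e)\<close> is coherent.\<close>
    have "\<forall>\<^sub>F e in sequentially. padic_of_int p (u e) N = L N \<and> padic_of_int p (u e) (Suc N) = L (Suc N)"
      using ev by (intro eventually_conj)
    then obtain e where "padic_of_int p (u e) N = L N" "padic_of_int p (u e) (Suc N) = L (Suc N)"
      using eventually_happens' trivial_limit_sequentially by blast
    with mem[of e] show ?thesis
      unfolding padic_ints_def by (metis (mono_tags, lifting) mem_Collect_eq)
  qed
  then have "L \<in> padic_ints p"
    by (simp add: padic_ints_def)
  then show ?thesis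
    using ev by (auto simp: limitin_padic_iff[OF p mem])
qed

theorem theorem1p1:
  fixes p :: nat and a b c d :: int
  assumes "prime p" and "0 \<le> b" and "b \<le> a"
  shows "\<exists>L \<in> padic_ints p.
    limitin (padic_topology p)
      (\<lambda>e. padic_of_int p (Stirling_int (int p ^ e * a + c) (int p ^ e * b + d)))
      L sequentially"
  by (rule padic_convergent_if_eventually_const_mod[OF assms(1) eventually_const_mod_Stirling_int[OF assms]])

end
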